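(* For every integer $n>0$, the integer $b(n)$ is the smallest integer of the form $n-p^k$, where $p^k$ is a prime power less than or equal to $n$.
   Context: For any integer $n>0$, $b(n)\ge 0$ is the smallest integer $b\ge0$ such that the set of binomial coefficients $\binom{n}{m}$, where $b<m<n-b$, has a non-trivial common divisor (i.e. a common divisor greater than $1$; this holds vacuously when there is no integer $m$ with $b<m<n-b$). A prime power is $p^k$ with $p$ prime and $k\ge 0$ an integer (the value $p^0=1$ matters only for $n=1$). *)

theory Defs
  imports "HOL-Computational_Algebra.Primes"
begin

text \<open>The exponent \<open>k = 0\<close> is allowed, so \<open>1\<close> counts as a prime power here,
  unlike for the library predicate \<open>primepow\<close>.\<close>

definition prime_power :: "nat \<Rightarrow> bool" where
  "prime_power q \<longleftrightarrow> (\<exists>p k. prime p \<and> q = p ^ k)"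

text \<open>The bound \<open>m < n - b\<close> is written \<open>m + b < n\<close> to avoid truncated subtraction.\<close>

definition has_common_divisor :: "nat \<Rightarrow> nat \<Rightarrow> bool" where
  "has_common_divisor n b \<longleftrightarrow>
     (\<exists>d>1. \<forall>m. b < m \<and> m + b < n \<longrightarrow> d dvd (n choose m))"

definition b :: "nat \<Rightarrow> nat" where
  "b n = (LEAST c. has_common_divisor n c)"

text \<open>The sets whose least elements are taken are nonempty, so \<open>LEAST\<close> is meaningful.\<close>

lemma has_common_divisor_self: "has_common_divisor n n"
  unfolding has_common_divisor_def by (intro exI[of _ 2]) auto

lemma prime_power_1: "prime_power 1"
  unfolding prime_power_def by (intro exI[of _ 2] exI[of _ 0]) auto

end

theory Submission
  imports Defs Complex_Main
begin

text \<open>Legendre's formula shows that \<open>p\<close> divides \<open>n choose m\<close> for \<open>n - p ^ k < m < p ^ k \<le> n\<close>,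
  and that \<open>p\<close> does not divide \<open>n choose i * p ^ k\<close> when \<open>i * p ^ k \<le> n < p ^ (k + 1)\<close>.
  The former bounds \<open>b n\<close> from above.  For the lower bound, let \<open>q \<le> n\<close> be the largest prime power;
  if some \<open>i * p ^ k\<close> lies in \<open>[n - q, q]\<close>, then \<open>p\<close> is not a common divisor for any \<open>c < n - q\<close>.
  Taking \<open>i * p ^ k\<close> to be the multiple of \<open>p ^ k\<close> near \<open>n / 2\<close>, this holds as soon as
  \<open>2 * n \<le> 3 * q\<close>, so it remains to find a prime between \<open>2 * n / 3\<close> and \<open>n\<close>.
  That is obtained by Chebyshev's method from
  \<open>(30 * m)! * m! / ((15 * m)! * (10 * m)! * (6 * m)!)\<close> for large \<open>n\<close>, and from an explicit
  chain of primes for small \<open>n\<close>.\<close>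

subsection \<open>Legendre's formula\<close>

lemma multiplicity_eq_sum_dvd:
  fixes p n :: nat
  assumes "prime p" "n > 0" "n < p ^ J"
  shows "multiplicity p n = (\<Sum>j=1..J. if p ^ j dvd n then 1 else 0)"
proof -
  have dvd_iff: "p ^ j dvd n \<longleftrightarrow> j \<le> multiplicity p n" for j
    using assms by (intro power_dvd_iff_le_multiplicity) (auto simp: prime_nat_iff)
  have "p ^ multiplicity p n \<le> n"
    using assms(2) by (intro dvd_imp_le multiplicity_dvd)
  then have "p ^ multiplicity p n < p ^ J"
    using assms(3) by linarith
  then have "multiplicity p n < J"
    using assms(1) by (meson power_less_imp_less_exp prime_gt_1_nat)
  then have "{1..J} \<inter> {j. p ^ j dvd n} = {1..multiplicity p n}"
    by (auto simp: dvd_iff)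
  then show ?thesis
    by (simp add: sum.If_cases)
qed

lemma div_Suc_eq_div_plus_dvd:
  fixes n q :: nat
  shows "Suc n div q = n div q + (if q dvd Suc n then 1 else 0)"
  by (simp add: div_Suc dvd_eq_mod_eq_0)

text \<open>Passing from \<open>n\<close> to \<open>Suc n\<close> raises \<open>n div p ^ j\<close>
  by one exactly when \<open>p ^ j\<close> divides \<open>Suc n\<close>. The bound \<open>J\<close>
  is left free so that several factorials can be expanded over one range.\<close>

lemma multiplicity_fact:
  fixes p :: nat
  assumes "prime p" "n < p ^ J"
  shows "multiplicity p (fact n) = (\<Sum>j=1..J. n div p ^ j)"
  using assms(2)
proof (induction n)
  case (Suc n)
  have "multiplicity p (fact (Suc n) :: nat) = multiplicity p (Suc n * fact n)"
    by simp
  also have "\<dots> = multiplicity p (Suc n) + multiplicity p (fact n :: nat)"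
    using assms(1) by (intro prime_elem_multiplicity_mult_distrib) auto
  also have "\<dots> = (\<Sum>j=1..J. Suc n div p ^ j)"
    using Suc multiplicity_eq_sum_dvd[OF assms(1) _ Suc.prems]
    by (simp add: div_Suc_eq_div_plus_dvd sum.distrib)
  finally show ?case .
qed simp

lemma multiplicity_binomial:
  fixes p :: nat
  assumes "prime p" "n < p ^ J" "m \<le> n"
  shows "multiplicity p (n choose m) + (\<Sum>j=1..J. m div p ^ j + (n - m) div p ^ j) =
    (\<Sum>j=1..J. n div p ^ j)"
proof -
  have "multiplicity p (fact n :: nat) =
      multiplicity p (fact m * fact (n - m) * (n choose m))"
    using binomial_fact_lemma[OF assms(3)] by simp
  also have "\<dots> = multiplicity p (fact m :: nat) + multiplicity p (fact (n - m) :: nat)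
      + multiplicity p (n choose m)"
    using assms by (simp add: prime_elem_multiplicity_mult_distrib)
  moreover have "m < p ^ J" "n - m < p ^ J"
    using assms by linarith+
  ultimately show ?thesis
    using assms by (simp add: multiplicity_fact sum.distrib)
qed

text \<open>In Legendre's formula the quotients of \<open>m\<close> and \<open>n - m\<close> never
  add up to more than that of \<open>n\<close>. At \<open>j = k\<close> the inequality is strict,
  since \<open>m\<close> and \<open>n - m\<close> lie below \<open>p ^ k\<close> while
  \<open>n\<close> does not.\<close>

lemma prime_dvd_binomial_between:
  assumes "prime p" "k > 0" "p ^ k \<le> n" "n - p ^ k < m" "m < p ^ k"
  shows "p dvd n choose m"
proof -
  have m: "m \<le> n"
    using assms by linarith
  have p1: "p > 1"
    using assms(1) by (rule prime_gt_1_nat)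
  have nJ: "n < p ^ n"
    using p1 by (intro power_gt_expt) simp
  have kn: "k \<le> n"
    using assms(3) power_gt_expt[of p k] p1 by simp
  have le: "m div p ^ j + (n - m) div p ^ j \<le> n div p ^ j" for j
    using m by (metis div_add1_eq le_add1 le_add_diff_inverse)
  have "(\<Sum>j=1..n. m div p ^ j + (n - m) div p ^ j) < (\<Sum>j=1..n. n div p ^ j)"
  proof (rule sum_strict_mono_ex1)
    have "n - m < p ^ k" "n div p ^ k > 0"
      using assms m by (auto simp: div_greater_zero_iff prime_gt_0_nat)
    then show "\<exists>j\<in>{1..n}. m div p ^ j + (n - m) div p ^ j < n div p ^ j"
      using assms kn by (intro bexI[of _ k]) auto
  qed (use le in auto)
  then have "multiplicity p (n choose m) > 0"
    using multiplicity_binomial[OF assms(1) nJ m] by linarith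
  then show ?thesis
    using not_dvd_imp_multiplicity_0 by fastforce
qed

text \<open>For \<open>j \<le> k\<close> the power \<open>p ^ j\<close> divides
  \<open>i * p ^ k\<close>, so the quotients add up exactly; for \<open>j = Suc k\<close> all three
  vanish.\<close>

lemma prime_not_dvd_binomial_mult_power:
  assumes "prime p" "n < p ^ Suc k" "i * p ^ k \<le> n"
  shows "\<not> p dvd n choose (i * p ^ k)"
proof -
  have "i * p ^ k div p ^ j + (n - i * p ^ k) div p ^ j = n div p ^ j"
    if "j \<in> {1..Suc k}" for j
  proof (cases "j \<le> k")
    case True
    then have "p ^ j dvd i * p ^ k"
      by (simp add: le_imp_power_dvd)
    then show ?thesis
      by (metis assms(3) div_plus_div_distrib_dvd_left le_add_diff_inverse)
  next
    case False
    then have "j = Suc k"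
      using that by simp
    then show ?thesis
      using assms by (simp del: power_Suc)
  qed
  then have "multiplicity p (n choose (i * p ^ k)) = 0"
    using multiplicity_binomial[OF assms] by simp
  moreover have "n choose (i * p ^ k) \<noteq> 0"
    using assms(3) by simp
  ultimately show ?thesis
    using assms(1) by (metis prime_imp_prime_elem prime_multiplicity_gt_zero_iff less_irrefl)
qed

lemma finite_primes_le [simp]: "finite {p::nat. prime p \<and> p \<le> n}"
  by (rule finite_subset[of _ "{..n}"]) auto

text \<open>Primes above \<open>n\<close> contribute zero. The common bound \<open>M\<close> allows
  logarithms of several factorials to be combined prime by prime.\<close>

lemma ln_fact_eq_sum_primes:
  assumes "n \<le> M"
  shows "ln (fact n) = (\<Sum>p | prime p \<and> p \<le> M. real (\<Sum>j=1..M. n div p ^ j) * ln (real p))"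
proof -
  have pf: "prime_factors (fact n :: nat) = {p. prime p \<and> p \<le> n}"
    by (auto simp: prime_factors_dvd prime_dvd_fact_iff)
  have "ln (fact n) = ln (real (fact n))"
    by simp
  also have "(fact n :: nat) = (\<Prod>p | prime p \<and> p \<le> n. p ^ multiplicity p (fact n))"
    using prime_factorization_nat[of "fact n"] by (simp add: pf)
  also have "ln (real \<dots>) =
      (\<Sum>p | prime p \<and> p \<le> n. real (multiplicity p (fact n :: nat)) * ln (real p))"
    by (subst of_nat_prod, subst ln_prod)
       (auto intro!: sum.cong simp: ln_realpow prime_gt_0_nat)
  also have "\<dots> = (\<Sum>p | prime p \<and> p \<le> n. real (\<Sum>j=1..M. n div p ^ j) * ln (real p))"
  proof (intro sum.cong refl arg_cong2[where f = "(*)"] arg_cong[where f = real] multiplicity_fact)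
    fix p assume "p \<in> {p. prime p \<and> p \<le> n}"
    then show "prime p" "n < p ^ M"
      using power_gt_expt[of p M] assms by (auto simp: prime_nat_iff)
  qed
  also have "\<dots> = (\<Sum>p | prime p \<and> p \<le> M. real (\<Sum>j=1..M. n div p ^ j) * ln (real p))"
  proof (rule sum.mono_neutral_left)
    show "\<forall>p\<in>{p. prime p \<and> p \<le> M} - {p. prime p \<and> p \<le> n}.
        real (\<Sum>j=1..M. n div p ^ j) * ln (real p) = 0"
    proof
      fix p assume p: "p \<in> {p. prime p \<and> p \<le> M} - {p. prime p \<and> p \<le> n}"
      have "n div p ^ j = 0" if "j \<in> {1..M}" for j
      proof -
        have "p ^ 1 \<le> p ^ j"
          using p that by (intro power_increasing) (auto simp: prime_ge_1_nat)
        then have "n < p ^ j"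
          using p by auto
        then show ?thesis
          by simp
      qed
      then show "real (\<Sum>j=1..M. n div p ^ j) * ln (real p) = 0"
        by simp
    qed
  qed (use assms in auto)
  finally show ?thesis .
qed

subsection \<open>Chebyshev's estimates\<close>

definition chebyshev_theta :: "nat \<Rightarrow> real" where
  "chebyshev_theta n = (\<Sum>p | prime p \<and> p \<le> n. ln (real p))"

lemma chebyshev_theta_mono:
  assumes "m \<le> n"
  shows "chebyshev_theta m \<le> chebyshev_theta n"
  unfolding chebyshev_theta_def
  by (rule sum_mono2) (use assms in \<open>auto dest: prime_gt_0_nat\<close>)

lemma chebyshev_theta_eq_if_no_primes:
  assumes "\<not> (\<exists>p. prime p \<and> m < p \<and> p \<le> n)" "m \<le> n"
  shows "chebyshev_theta n = chebyshev_theta m"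
proof -
  have "{p. prime p \<and> p \<le> n} = {p. prime p \<and> p \<le> m}"
    using assms by (meson leI le_trans)
  then show ?thesis
    by (simp add: chebyshev_theta_def)
qed

lemma chebyshev_theta_le_mult_ln:
  "chebyshev_theta n \<le> real n * ln (real n)"
proof -
  have "chebyshev_theta n \<le> real (card {p::nat. prime p \<and> p \<le> n}) * ln (real n)"
    unfolding chebyshev_theta_def
    by (rule sum_bounded_above) (auto dest: prime_gt_0_nat)
  also have "\<dots> \<le> real n * ln (real n)"
  proof (rule mult_right_mono)
    have "card {p::nat. prime p \<and> p \<le> n} \<le> card {1..n}"
      by (rule card_mono) (auto dest: prime_ge_1_nat)
    then show "real (card {p::nat. prime p \<and> p \<le> n}) \<le> real n"
      by simp
    show "0 \<le> ln (real n)"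
      by (cases "n = 0") auto
  qed
  finally show ?thesis .
qed

text \<open>Below, \<open>chebyshev_step (30 * m div p ^ j)\<close> is the contribution of \<open>p ^ j\<close> to the exponent of
  \<open>p\<close> in \<open>(30 * m)! * m! / ((15 * m)! * (10 * m)! * (6 * m)!)\<close>.\<close>

definition chebyshev_step :: "nat \<Rightarrow> nat" where
  "chebyshev_step t = t + t div 30 - t div 2 - t div 3 - t div 5"

text \<open>Because 1/2 + 1/3 + 1/5 = 1 + 1/30, multiples of 30 cancel and only the residues modulo
  30 need checking. The equation also shows that no subtraction in \<open>chebyshev_step\<close> is
  truncated.\<close>

lemma chebyshev_step_eq:
  "t + t div 30 = t div 2 + t div 3 + t div 5 + chebyshev_step t"
  and chebyshev_step_le_1: "chebyshev_step t \<le> 1"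
proof -
  define c s where "c = t div 30" and "s = t mod 30"
  have t: "t = 30 * c + s" and s: "s < 30"
    by (simp_all add: c_def s_def)
  have d: "t div 30 = c" "t div 2 = 15 * c + s div 2" "t div 3 = 10 * c + s div 3"
    "t div 5 = 6 * c + s div 5"
    using s by (simp_all add: t)
  have "s \<in> {..<30}"
    using s by simp
  also have "{..<30::nat} = set [0..<30]"
    by auto
  finally have "s div 2 + s div 3 + s div 5 \<le> s \<and> s \<le> s div 2 + s div 3 + s div 5 + 1"
    by (simp add: upt_rec) auto
  then show "t + t div 30 = t div 2 + t div 3 + t div 5 + chebyshev_step t" "chebyshev_step t \<le> 1"
    unfolding chebyshev_step_def d by (simp_all add: t)
qed

text \<open>These are the values of \<open>30 * m div p\<close> for
  \<open>5 * m < p \<le> 30 * m\<close>; the step function first returns to 0 at 6.\<close>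

lemma chebyshev_step_eq_1:
  assumes "0 < t" "t < 6"
  shows "chebyshev_step t = 1"
proof -
  have "t \<in> {1, 2, 3, 4, 5}"
    using assms by auto
  then show ?thesis
    by (auto simp: chebyshev_step_def)
qed

lemma chebyshev_step_0 [simp]: "chebyshev_step 0 = 0"
  by (simp add: chebyshev_step_def)

definition ln_chebyshev_quotient :: "nat \<Rightarrow> real" where
  "ln_chebyshev_quotient m =
     ln (fact (30 * m)) + ln (fact m) - ln (fact (15 * m)) - ln (fact (10 * m)) - ln (fact (6 * m))"

lemma ln_chebyshev_quotient_eq_sum_primes:
  "ln_chebyshev_quotient m =
    (\<Sum>p | prime p \<and> p \<le> 30 * m.
       real (\<Sum>j=1..30 * m. chebyshev_step (30 * m div p ^ j)) * ln (real p))"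
proof -
  define M where "M = 30 * m"
  define S where "S = (\<lambda>(k::nat) (p::nat). \<Sum>j=1..M. k div p ^ j)"
  define C where "C = (\<lambda>p. \<Sum>j=1..M. chebyshev_step (M div p ^ j))"
  \<comment> \<open>Here \<open>15 * m div q = M div q div 2\<close>, and likewise for the divisors
    3, 5 and 30.\<close>
  have "M div q + m div q = 15 * m div q + 10 * m div q + 6 * m div q + chebyshev_step (M div q)" for q
    using chebyshev_step_eq[of "M div q"]
    by (simp add: M_def div_mult2_eq[symmetric] mult.commute[of q])
  then have SC: "S M p + S m p = S (15 * m) p + S (10 * m) p + S (6 * m) p + C p" for p
    by (simp add: S_def C_def flip: sum.distrib)
  have "real (C p) = real (S M p) + real (S m p) - real (S (15 * m) p)
      - real (S (10 * m) p) - real (S (6 * m) p)" for p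
    using arg_cong[OF SC[of p], of real] by simp
  moreover have "m \<le> M" "15 * m \<le> M" "10 * m \<le> M" "6 * m \<le> M"
    by (simp_all add: M_def)
  ultimately have "(\<Sum>p | prime p \<and> p \<le> M. real (C p) * ln (real p)) = ln_chebyshev_quotient m"
    unfolding ln_chebyshev_quotient_def
    by (subst (1 2 3 4 5) ln_fact_eq_sum_primes[where M = M])
       (simp_all add: M_def[symmetric] S_def left_diff_distrib distrib_right sum.distrib sum_subtractf)
  then show ?thesis
    by (simp add: M_def C_def)
qed

text \<open>All exponents in the quotient are nonnegative, and for a prime in
  \<open>(5 * m, 30 * m]\<close> the term \<open>j = 1\<close> alone already gives exponent at least
  1.\<close>

lemma chebyshev_theta_diff_le:
  "chebyshev_theta (30 * m) \<le> chebyshev_theta (5 * m) + ln_chebyshev_quotient m"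
proof -
  define w where "w = (\<lambda>p. real (\<Sum>j=1..30 * m. chebyshev_step (30 * m div p ^ j)))"
  have w1: "w p \<ge> 1" if p: "prime p" "5 * m < p" "p \<le> 30 * m" for p
  proof -
    have "0 < 30 * m div p" "30 * m div p < 6"
      using p by (auto simp: div_greater_zero_iff prime_gt_0_nat div_less_iff_less_mult)
    then have "1 = (\<Sum>j\<in>{1}. chebyshev_step (30 * m div p ^ j))"
      by (simp add: chebyshev_step_eq_1)
    also have "\<dots> \<le> (\<Sum>j=1..30 * m. chebyshev_step (30 * m div p ^ j))"
      by (rule sum_mono2) (use p in auto)
    finally show ?thesis
      unfolding w_def by (metis of_nat_1 of_nat_le_iff)
  qed
  have "chebyshev_theta (30 * m) =
      (\<Sum>p | prime p \<and> p \<le> 30 * m. (if p \<le> 5 * m then ln (real p) else 0) +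
        (if p \<le> 5 * m then 0 else ln (real p)))"
    unfolding chebyshev_theta_def by (rule sum.cong) auto
  also have "\<dots> = chebyshev_theta (5 * m) +
      (\<Sum>p | prime p \<and> p \<le> 30 * m. if p \<le> 5 * m then 0 else ln (real p))"
    by (auto simp: sum.distrib chebyshev_theta_def simp flip: sum.inter_filter intro!: sum.cong)
  also have "(\<Sum>p | prime p \<and> p \<le> 30 * m. if p \<le> 5 * m then 0 else ln (real p)) \<le>
      (\<Sum>p | prime p \<and> p \<le> 30 * m. w p * ln (real p))"
  proof (rule sum_mono)
    fix p assume "p \<in> {p. prime p \<and> p \<le> 30 * m}"
    then have p: "prime p" "p \<le> 30 * m" by auto
    then have "ln (real p) \<ge> 0" "w p \<ge> 0"
      unfolding w_def by (auto dest: prime_ge_1_nat simp del: of_nat_sum)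
    then show "(if p \<le> 5 * m then 0 else ln (real p)) \<le> w p * ln (real p)"
      using w1[OF p(1) _ p(2)] by (auto simp: mult_le_cancel_right1 not_le)
  qed
  finally show ?thesis
    by (simp add: ln_chebyshev_quotient_eq_sum_primes w_def)
qed

text \<open>Each power \<open>p ^ j \<le> 30 * m\<close> adds at most 1 to the exponent of
  \<open>p\<close>. So a prime contributes at most \<open>ln p\<close> if its square exceeds
  \<open>30 * m\<close>, and at most \<open>ln (30 * m)\<close> otherwise; the latter primes number
  at most \<open>sqrt (30 * m)\<close>.\<close>

lemma ln_chebyshev_quotient_le_theta:
  "ln_chebyshev_quotient m \<le>
    chebyshev_theta (30 * m) + sqrt (real (30 * m)) * ln (real (30 * m))"
proof (cases "m = 0")
  case False
  define X where "X = 30 * m"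
  define w where "w = (\<lambda>p. \<Sum>j=1..X. chebyshev_step (X div p ^ j))"
  have X: "X \<ge> 1"
    using False by (simp add: X_def)
  have w_le: "w p \<le> k" if "X < p ^ Suc k" "prime p" for p k
  proof -
    have "chebyshev_step (X div p ^ j) = 0" if "j \<notin> {1..k}" "j \<in> {1..X}" for j
    proof -
      have "p ^ Suc k \<le> p ^ j"
        using that \<open>prime p\<close> by (intro power_increasing) (auto simp: Suc_le_eq prime_gt_0_nat)
      then show ?thesis
        using \<open>X < p ^ Suc k\<close> by simp
    qed
    then have "w p = (\<Sum>j\<in>{1..X} \<inter> {1..k}. chebyshev_step (X div p ^ j))"
      unfolding w_def by (intro sum.mono_neutral_right) auto
    also have "\<dots> \<le> of_nat (card ({1..X} \<inter> {1..k})) * 1"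
      by (rule sum_bounded_above) (rule chebyshev_step_le_1)
    also have "\<dots> \<le> card {1..k}"
      by (auto intro: card_mono)
    finally show ?thesis by simp
  qed
  let ?R = "{p. prime p \<and> p \<le> X \<and> p\<^sup>2 \<le> X}"
  have "ln_chebyshev_quotient m = (\<Sum>p | prime p \<and> p \<le> X. real (w p) * ln (real p))"
    by (simp add: ln_chebyshev_quotient_eq_sum_primes X_def w_def)
  also have "\<dots> \<le> (\<Sum>p | prime p \<and> p \<le> X. ln (real p) + (if p\<^sup>2 \<le> X then ln (real X) else 0))"
  proof (rule sum_mono)
    fix p assume "p \<in> {p. prime p \<and> p \<le> X}"
    then have p: "prime p" "p \<le> X" by auto
    have lnp: "ln (real p) \<ge> 0"
      using p(1) by (auto dest: prime_ge_1_nat)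
    show "real (w p) * ln (real p) \<le> ln (real p) + (if p\<^sup>2 \<le> X then ln (real X) else 0)"
    proof (cases "p\<^sup>2 \<le> X")
      case True
      obtain k where k: "p ^ k \<le> X" "X < p ^ Suc k"
        using ex_power_ivl1[of p X] p X prime_ge_2_nat[of p] by auto
      have "real (w p) * ln (real p) \<le> real k * ln (real p)"
        using w_le[OF k(2) p(1)] lnp by (intro mult_right_mono) auto
      also have "\<dots> = ln (real (p ^ k))"
        using p by (simp add: ln_realpow prime_gt_0_nat)
      also have "\<dots> \<le> ln (real X)"
        using k p X prime_gt_0_nat[of p] by (subst ln_le_cancel_iff) (auto simp flip: of_nat_power)
      finally show ?thesis
        using True lnp by simp
    next
      case False
      then have "w p \<le> 1"
        using p by (intro w_le) (auto simp: power2_eq_square)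
      then have "real (w p) * ln (real p) \<le> 1 * ln (real p)"
        using lnp by (intro mult_right_mono) auto
      then show ?thesis
        using False by simp
    qed
  qed
  also have "\<dots> = chebyshev_theta X + real (card ?R) * ln (real X)"
    by (simp add: sum.distrib chebyshev_theta_def flip: sum.inter_filter)
  also have "real (card ?R) * ln (real X) \<le> sqrt (real X) * ln (real X)"
  proof (rule mult_right_mono)
    define r where "r = nat \<lfloor>sqrt (real X)\<rfloor>"
    have "?R \<subseteq> {1..r}"
    proof
      fix p assume p: "p \<in> ?R"
      then have "real p ^ 2 \<le> real X"
        by (auto simp flip: of_nat_power)
      then have "real p \<le> sqrt (real X)"
        by (rule real_le_rsqrt)
      then show "p \<in> {1..r}"
        using p by (auto simp: r_def le_nat_floor dest: prime_ge_1_nat)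
    qed
    then have "card ?R \<le> card {1..r}"
      by (intro card_mono) auto
    then have "real (card ?R) \<le> real r"
      by simp
    also have "\<dots> \<le> sqrt (real X)"
      by (simp add: r_def)
    finally show "real (card ?R) \<le> sqrt (real X)" .
  qed (use X in auto)
  finally show ?thesis
    by (simp add: X_def)
qed (simp add: ln_chebyshev_quotient_def chebyshev_theta_def)

text \<open>A weak Stirling formula, by induction from 1 / (n + 1) <= ln (n + 1) - ln n <= 1 /
  n.\<close>

lemma ln_fact_bounds:
  assumes "n > 0"
  shows "real n * ln (real n) - real n + 1 \<le> ln (fact n)"
    and "ln (fact n) \<le> real n * ln (real n) - real n + 1 + ln (real n)"
proof -
  have "real n * ln (real n) - real n + 1 \<le> ln (fact n) \<and>
      ln (fact n) \<le> real n * ln (real n) - real n + 1 + ln (real n)"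
    using assms
  proof (induction n rule: nat_induct_non_zero)
    case (Suc n)
    define x where "x = real n"
    have x: "x > 0"
      using Suc.hyps by (simp add: x_def)
    have "ln ((1 + x) / x) \<le> (1 + x) / x - 1" "ln (x / (1 + x)) \<le> x / (1 + x) - 1"
      using x by (intro ln_le_minus_one; simp)+
    then have "ln (1 + x) - ln x \<le> 1 / x" "1 / (1 + x) \<le> ln (1 + x) - ln x"
      using x by (auto simp: ln_div field_simps)
    then have "x * (ln (1 + x) - ln x) \<le> 1" "1 \<le> (1 + x) * (ln (1 + x) - ln x)"
      using x by (auto simp: field_simps)
    moreover have "ln (fact (Suc n)) = ln (1 + x) + ln (fact n)"
      using x by (simp add: x_def ln_mult add.commute)
    ultimately show ?case
      using Suc.IH by (simp add: x_def[symmetric] algebra_simps)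
  qed simp
  then show "real n * ln (real n) - real n + 1 \<le> ln (fact n)"
    and "ln (fact n) \<le> real n * ln (real n) - real n + 1 + ln (real n)"
    by auto
qed

text \<open>A tangent bound at \<open>2 ^ k\<close> with \<open>ln 2\<close> rounded up to 1; the
  choice of \<open>k\<close> trades slope against constant in the numerical estimates.\<close>

lemma ln_le_divide_power_2:
  fixes x :: real
  assumes "x > 0"
  shows "ln x \<le> x / 2 ^ k + real k - 1"
proof -
  have "ln x = ln (x / 2 ^ k) + real k * ln 2"
    using assms by (simp add: ln_div ln_realpow)
  also have "ln (x / 2 ^ k) \<le> x / 2 ^ k - 1"
    using assms by (intro ln_le_minus_one) simp
  also have "real k * ln 2 \<le> real k * 1"
    using ln_2_less_1 by (intro mult_left_mono) auto
  finally show ?thesis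
    by simp
qed

text \<open>This is 30 times Chebyshev's constant ln (2^(1/2) * 3^(1/3) * 5^(1/5) / 30^(1/30)), the
  growth rate of \<open>ln_chebyshev_quotient m\<close> in \<open>m\<close>.\<close>

definition chebyshev_const :: real where
  "chebyshev_const = 14 * ln 2 + 9 * ln 3 + 5 * ln 5"

lemma chebyshev_const_ge: "chebyshev_const \<ge> 24"
proof -
  have "exp 24 = exp (1::real) ^ 24"
    by (simp flip: exp_of_nat_mult)
  also have "\<dots> \<le> 3 ^ 24"
    by (intro power_mono exp_le) auto
  also have "\<dots> \<le> (2 ^ 14 * 3 ^ 9 * 5 ^ 5 :: real)"
    by simp
  finally have "24 \<le> ln (2 ^ 14 * 3 ^ 9 * 5 ^ 5 :: real)"
    by (subst ln_ge_iff) auto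
  also have "\<dots> = chebyshev_const"
    unfolding chebyshev_const_def by (simp only: ln_mult ln_realpow) (simp add: ln_mult ln_realpow)
  finally show ?thesis .
qed

text \<open>Since 30 + 1 = 15 + 10 + 6, the terms \<open>m * ln m\<close> and the linear terms
  \<open>- n\<close> of Stirling's formula cancel. The errors come from two factorials above and
  three below the fraction bar.\<close>

lemma ln_chebyshev_quotient_bounds:
  assumes "m > 0"
  shows "ln_chebyshev_quotient m \<le> chebyshev_const * real m + 2 * ln (real (30 * m))"
    and "chebyshev_const * real m - 1 - 3 * ln (real (30 * m)) \<le> ln_chebyshev_quotient m"
proof -
  define L where "L = ln (real m)"
  have "ln (30::real) = ln (2 * 3 * 5)" "ln (15::real) = ln (3 * 5)"
    "ln (10::real) = ln (2 * 5)" "ln (6::real) = ln (2 * 3)"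
    by simp_all
  then have logs: "ln (30::real) = ln 2 + ln 3 + ln 5" "ln (15::real) = ln 3 + ln 5"
    "ln (10::real) = ln 2 + ln 5" "ln (6::real) = ln 2 + ln 3"
    by (simp_all only: ln_mult) (simp_all add: ln_mult)
  have mul: "ln (real (30 * m)) = ln 2 + ln 3 + ln 5 + L"
    "ln (real (15 * m)) = ln 3 + ln 5 + L" "ln (real (10 * m)) = ln 2 + ln 5 + L"
    "ln (real (6 * m)) = ln 2 + ln 3 + L"
    using assms by (simp_all add: ln_mult L_def logs)
  have pos: "ln (2::real) \<ge> 0" "ln (3::real) \<ge> 0" "ln (5::real) \<ge> 0" "L \<ge> 0"
    using assms by (auto simp: L_def)
  \<comment> \<open>Naming the nonlinear products leaves only linear arithmetic.\<close>
  define A B C D where "A = real m * ln 2" and "B = real m * ln 3" and "C = real m * ln 5"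
    and "D = real m * L"
  have prod: "real m * ln (real m) = D" "real (30 * m) * ln (real (30 * m)) = 30 * A + 30 * B + 30 * C + 30 * D"
    "real (15 * m) * ln (real (15 * m)) = 15 * B + 15 * C + 15 * D"
    "real (10 * m) * ln (real (10 * m)) = 10 * A + 10 * C + 10 * D"
    "real (6 * m) * ln (real (6 * m)) = 6 * A + 6 * B + 6 * D"
    unfolding mul by (simp_all add: A_def B_def C_def D_def L_def algebra_simps)
  have "30 * m > 0" "15 * m > 0" "10 * m > 0" "6 * m > 0"
    using assms by simp_all
  note bounds = ln_fact_bounds[OF assms, unfolded prod, folded L_def]
    this(1)[THEN ln_fact_bounds(1), unfolded prod, unfolded mul]
    this(1)[THEN ln_fact_bounds(2), unfolded prod, unfolded mul]
    this(2)[THEN ln_fact_bounds(1), unfolded prod, unfolded mul]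
    this(2)[THEN ln_fact_bounds(2), unfolded prod, unfolded mul]
    this(3)[THEN ln_fact_bounds(1), unfolded prod, unfolded mul]
    this(3)[THEN ln_fact_bounds(2), unfolded prod, unfolded mul]
    this(4)[THEN ln_fact_bounds(1), unfolded prod, unfolded mul]
    this(4)[THEN ln_fact_bounds(2), unfolded prod, unfolded mul]
  have const: "chebyshev_const * real m = 14 * A + 9 * B + 5 * C"
    by (simp add: chebyshev_const_def A_def B_def C_def algebra_simps)
  show "ln_chebyshev_quotient m \<le> chebyshev_const * real m + 2 * ln (real (30 * m))"
    using bounds pos unfolding ln_chebyshev_quotient_def const mul unfolding of_nat_mult of_nat_numeral
    by (simp only: distrib_left)
  show "chebyshev_const * real m - 1 - 3 * ln (real (30 * m)) \<le> ln_chebyshev_quotient m"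
    using bounds pos unfolding ln_chebyshev_quotient_def const mul unfolding of_nat_mult of_nat_numeral
    by (simp only: distrib_left)
qed

text \<open>Bounding \<open>\<theta>(30 * m) - \<theta>(5 * m)\<close> repeatedly would give the factor \<open>1 / 25\<close>; the weaker
  \<open>1 / 24\<close> absorbs the logarithmic error terms.\<close>

lemma chebyshev_theta_le:
  "chebyshev_theta n \<le> chebyshev_const / 24 * real n + 20000"
proof (induction n rule: less_induct)
  case (less n)
  show ?case
  \<comment> \<open>The cutoff makes \<open>m > 60\<close> in the other case, as the bound on
    \<open>2 * ln (30 * m)\<close> requires; 20000 covers \<open>1800 * ln 1800\<close>.\<close>
  proof (cases "n < 1800")
    case True
    have "chebyshev_theta n \<le> chebyshev_theta 1800"
      using True by (intro chebyshev_theta_mono) simp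
    also have "\<dots> \<le> 1800 * ln 1800"
      using chebyshev_theta_le_mult_ln[of 1800] by simp
    also have "\<dots> \<le> 20000"
      using ln_le_divide_power_2[of 1800 10] by simp
    also have "\<dots> \<le> chebyshev_const / 24 * real n + 20000"
      using chebyshev_const_ge by simp
    finally show ?thesis .
  next
    case False
    define m where "m = n div 30 + 1"
    have m: "n \<le> 30 * m" "30 * m \<le> n + 30" "m > 60"
      using False by (auto simp: m_def)
    then have "5 * m < n"
      by simp
    have "chebyshev_theta n \<le> chebyshev_theta (30 * m)"
      using m by (intro chebyshev_theta_mono)
    also have "\<dots> \<le> chebyshev_theta (5 * m) + ln_chebyshev_quotient m"
      by (rule chebyshev_theta_diff_le)
    also have "\<dots> \<le> (chebyshev_const / 24 * real (5 * m) + 20000) +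
        (chebyshev_const * real m + 2 * ln (real (30 * m)))"
      using less.IH[OF \<open>5 * m < n\<close>] ln_chebyshev_quotient_bounds(1)[of m] m by simp
    \<comment> \<open>Rounding \<open>n\<close> up to \<open>30 * m\<close> costs at most 30, which
      is saved here. With K = \<open>chebyshev_const / 24\<close>, which is at least 1, the linear
      terms total K * (5 * m + 24 * m + m - 30), at most K * n.\<close>
    also have "2 * ln (real (30 * m)) \<le> real m - 30"
      using ln_le_divide_power_2[of "real (30 * m)" 8] m by simp
    also have "real m - 30 \<le> chebyshev_const / 24 * (real m - 30)"
      using mult_right_mono[of 1 "chebyshev_const / 24" "real m - 30"] chebyshev_const_ge m by simp
    also have "chebyshev_const / 24 * real (5 * m) + 20000 +
          (chebyshev_const * real m + chebyshev_const / 24 * (real m - 30)) =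
        chebyshev_const / 24 * (30 * real m - 30) + 20000"
      by (simp add: field_simps)
    also have "\<dots> \<le> chebyshev_const / 24 * real n + 20000"
      using chebyshev_const_ge m(2) by (intro add_mono mult_left_mono) auto
    finally show ?thesis
      by simp
  qed
qed

subsection \<open>Primes between two thirds of a number and the number\<close>

text \<open>Without such a prime, theta would agree at \<open>n\<close> and just below 2n/3. For K =
  \<open>chebyshev_const / 24\<close> and \<open>m = n div 30\<close>, the lower bound has main term
  24 * K * m and the upper bound only 20 * K * m. The threshold is the first \<open>n\<close> beyond
  the explicit chain of primes.\<close>

lemma large_prime_between_two_thirds:
  fixes n :: nat
  assumes "n \<ge> 221996"
  shows "\<exists>p. prime p \<and> p \<le> n \<and> 2 * n \<le> 3 * p"
proof (rule ccontr)
  assume none: "\<not> ?thesis"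
  \<comment> \<open>\<open>s\<close> is the largest integer with
    \<open>3 * s < 2 * n\<close>.\<close>
  define m s where "m = n div 30" and "s = (2 * n - 1) div 3"
  define X y where "X = real (30 * m)" and "y = sqrt X"
  have m: "30 * m \<le> n" "n < 30 * m + 30" "30 * m \<ge> 221967"
    using assms by (auto simp: m_def)
  have s: "s \<le> n" "s \<le> 20 * m + 20" "\<And>p. s < p \<Longrightarrow> 2 * n \<le> 3 * p"
    using m by (auto simp: s_def)
  have X: "X = 30 * real m" "X \<ge> 221967"
    using m(3) by (auto simp: X_def)
  have y: "y * y = X" "y \<ge> 471"
    using X by (auto simp: y_def intro: real_le_rsqrt)
  have lnX: "ln X \<le> X / 2 ^ 18 + 17"
    using ln_le_divide_power_2[of X 18] X by simp
  \<comment> \<open>Linearizing \<open>ln y\<close> rather than \<open>ln X\<close> bounds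
    \<open>y * ln X\<close> by a multiple of \<open>X\<close> with factor 1/128 + 14/471, well below
    the 4/30 coming from \<open>4 * m\<close>.\<close>
  have "ln X = 2 * ln y"
    using X by (simp add: y_def ln_sqrt)
  also have "\<dots> \<le> y / 128 + 14"
    using ln_le_divide_power_2[of y 8] y by simp
  finally have "y * ln X \<le> y * (y / 128 + 14)"
    using y by (intro mult_left_mono) auto
  also have "\<dots> = X / 128 + 14 * y"
    using y(1) by (simp add: algebra_simps)
  also have "y \<le> X / 471"
    using y mult_left_mono[of 471 y y] by simp
  finally have ylnX: "y * ln X \<le> X / 128 + 14 * (X / 471)"
    by simp
  have "chebyshev_const * real m - 1 - 3 * ln X \<le> ln_chebyshev_quotient m"
    using ln_chebyshev_quotient_bounds(2)[of m] m by (simp add: X_def)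
  also have "\<dots> \<le> chebyshev_theta (30 * m) + y * ln X"
    using ln_chebyshev_quotient_le_theta[of m] by (simp add: X_def y_def)
  also have "chebyshev_theta (30 * m) \<le> chebyshev_theta n"
    using m by (intro chebyshev_theta_mono)
  also have "\<dots> = chebyshev_theta s"
    using none s by (intro chebyshev_theta_eq_if_no_primes) auto
  also have "\<dots> \<le> chebyshev_const / 24 * real s + 20000"
    by (rule chebyshev_theta_le)
  also have "\<dots> \<le> chebyshev_const / 24 * (20 * real m + 20) + 20000"
    using s(2) chebyshev_const_ge by (intro add_mono mult_left_mono) auto
  finally have "chebyshev_const / 24 * (4 * real m - 20) \<le> 20001 + 3 * ln X + y * ln X"
    by (simp add: field_simps)
  moreover have "4 * real m - 20 \<le> chebyshev_const / 24 * (4 * real m - 20)"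
    using mult_right_mono[of 1 "chebyshev_const / 24" "4 * real m - 20"] chebyshev_const_ge X
    by simp
  ultimately have "4 * real m - 20 \<le> 20001 + 3 * ln X + y * ln X"
    by linarith
  then show False
    using X lnX ylnX by simp
qed

text \<open>Trial division with an explicit starting point, so that it can be unfolded by
  rewriting.\<close>

definition no_odd_divisor_from :: "nat \<Rightarrow> nat \<Rightarrow> bool" where
  "no_odd_divisor_from d n \<longleftrightarrow> (\<forall>e\<ge>d. odd e \<longrightarrow> e * e \<le> n \<longrightarrow> \<not> e dvd n)"

lemma no_odd_divisor_from_step:
  assumes "odd d"
  shows "no_odd_divisor_from d n \<longleftrightarrow>
    (if n < d * d then True else \<not> d dvd n \<and> no_odd_divisor_from (d + 2) n)"
proof -
  have "e = d \<or> d + 2 \<le> e" if "d \<le> e" "odd e" for e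
    using that assms by presburger
  moreover have "n < e * e" if "n < d * d" "d \<le> e" for e
    using that mult_le_mono[of d e d e] by linarith
  ultimately show ?thesis
    using assms unfolding no_odd_divisor_from_def
    by (smt (verit) add_leD1 not_less order_refl)
qed

text \<open>Only literal starting points are rewritten, and the \<open>if\<close> lets the stopping
  test be decided before the next unfolding.\<close>

lemmas no_odd_divisor_from_numeral = no_odd_divisor_from_step[of "numeral d" for d]

lemma prime_if_no_odd_divisor:
  fixes n :: nat
  assumes "n > 1" "odd n" "no_odd_divisor_from 3 n"
  shows "prime n"
proof (rule ccontr)
  assume "\<not> prime n"
  then obtain e where "e dvd n" "e \<noteq> 1" "e \<noteq> n"
    using assms(1) by (auto simp: prime_nat_iff)
  then obtain k where ek: "n = e * k" "k \<noteq> 1"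
    by (auto elim: dvdE)
  have "odd e" "odd k"
    using assms(2) ek(1) by simp_all
  moreover from this have "e \<ge> 3" "k \<ge> 3"
    using \<open>e \<noteq> 1\<close> \<open>k \<noteq> 1\<close> by presburger+
  moreover have "e * e \<le> n \<or> k * k \<le> n"
    using ek by (metis le_cases mult_le_mono1 mult_le_mono2)
  ultimately show False
    using assms(3) ek(1) unfolding no_odd_divisor_from_def by auto
qed

text \<open>If \<open>n\<close> lies between neighbours \<open>p \<le> n < q\<close>, then
  \<open>2 * n \<le> 2 * q - 2 \<le> 3 * p\<close>, which explains the slack of 2.\<close>

lemma ex_mem_chain:
  fixes n :: nat
  assumes "successively (\<lambda>p q. 2 * q \<le> 3 * p + 2) (a # ps)" "a \<le> n" "2 * n \<le> 3 * last (a # ps)"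
  shows "\<exists>p\<in>set (a # ps). p \<le> n \<and> 2 * n \<le> 3 * p"
  using assms
proof (induction ps arbitrary: a)
  case (Cons q ps)
  show ?case
  proof (cases "q \<le> n")
    case True
    then show ?thesis
      using Cons.IH[of q] Cons.prems by auto
  next
    case False
    then have "2 * n \<le> 3 * a"
      using Cons.prems(1) by simp
    then show ?thesis
      using Cons.prems(2) by auto
  qed
qed simp

lemma small_prime_between_two_thirds:
  fixes n :: nat
  assumes "2 \<le> n" "n \<le> 221995"
  shows "\<exists>p. prime p \<and> p \<le> n \<and> 2 * n \<le> 3 * p"
proof -
  \<comment> \<open>The prime 2 is kept apart because the test handles odd numbers only. The last
    entry reaches \<open>n = 221995\<close>, as 3 * 147997 = 2 * 221995 + 1.\<close>
  define ps :: "nat list" where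
    "ps = [3, 5, 7, 11, 17, 23, 31, 47, 71, 107, 157, 233, 349, 523, 773, 1153, 1723, 2579, 3863,
      5791, 8681, 13009, 19507, 29251, 43867, 65789, 98669, 147997]"
  have "\<forall>p\<in>set ps. p > 1 \<and> odd p \<and> no_odd_divisor_from 3 p"
    unfolding ps_def by (simp add: no_odd_divisor_from_numeral)
  then have "\<forall>p\<in>set (2 # ps). prime p"
    using prime_if_no_odd_divisor two_is_prime_nat by auto
  moreover have "\<exists>p\<in>set (2 # ps). p \<le> n \<and> 2 * n \<le> 3 * p"
    by (rule ex_mem_chain) (use assms in \<open>simp_all add: ps_def\<close>)
  ultimately show ?thesis
    by blast
qed

lemma prime_between_two_thirds:
  fixes n :: nat
  assumes "2 \<le> n"
  shows "\<exists>p. prime p \<and> p \<le> n \<and> 2 * n \<le> 3 * p"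
  using assms large_prime_between_two_thirds small_prime_between_two_thirds
  by (cases "n \<le> 221995") auto

subsection \<open>Common divisors of binomial coefficients\<close>

lemma has_common_divisor_imp_le:
  assumes "has_common_divisor n c" "prime_power q" "q \<le> n" "2 * n \<le> 3 * q"
    and max: "\<And>q'. prime_power q' \<Longrightarrow> q' \<le> n \<Longrightarrow> q' \<le> q"
  shows "n - q \<le> c"
proof (rule ccontr)
  assume "\<not> n - q \<le> c"
  then have c: "c + q < n" by simp
  obtain d where d: "d > 1" "\<And>m. c < m \<Longrightarrow> m + c < n \<Longrightarrow> d dvd n choose m"
    using assms(1) unfolding has_common_divisor_def by auto
  obtain p where p: "prime p" "p dvd d"
    using d(1) prime_factor_nat[of d] by auto
  obtain k where k: "p ^ k \<le> n" "n < p ^ Suc k"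
    using ex_power_ivl1[of p n] p(1) prime_ge_2_nat[of p] c by auto
  \<comment> \<open>Rounding \<open>a / 2\<close> up puts \<open>i * P\<close> near
    \<open>n / 2\<close>; \<open>P \<le> q\<close> will follow from the maximality of
    \<open>q\<close>.\<close>
  define P a r i where "P = p ^ k" and "a = n div P" and "r = n mod P" and "i = (a + 1) div 2"
  have P: "P > 0" "P \<le> q"
    using p(1) k max[of P] by (auto simp: P_def prime_gt_0_nat prime_power_def)
  have n: "n = a * P + r" "r < P"
    using P by (simp_all add: a_def r_def)
  have "a > 0"
    using k P by (simp add: a_def P_def div_greater_zero_iff)
  \<comment> \<open>It suffices that \<open>i * P\<close> and \<open>n - i * P\<close> are at most
    \<open>q\<close>. For \<open>a = 1\<close> they are \<open>P\<close> and \<open>r < P\<close>;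
    otherwise both are at most 2n/3, which is where \<open>2 * n \<le> 3 * q\<close> enters.\<close>
  then consider "a = 1" "i = 1" | "a = 2 * i" "i \<ge> 1" | "a + 1 = 2 * i" "i \<ge> 2"
    unfolding i_def by (cases "a = 1"; cases "even a") (auto elim!: evenE oddE)
  then have "i * P \<le> q \<and> n \<le> i * P + q \<and> i * P \<le> n"
  proof cases
    case 1
    then show ?thesis
      using n P by simp
  next
    case 2
    then have "n = 2 * (i * P) + r" "P \<le> i * P"
      using n by simp_all
    then show ?thesis
      using assms(4) n(2) by linarith
  next
    case 3
    then have "(a + 1) * P = 2 * (i * P)" "2 * P \<le> i * P"
      by (simp_all only: mult.assoc mult_le_mono1)
    then have "n + P = 2 * (i * P) + r" "2 * P \<le> i * P"
      using n(1) by simp_all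
    then show ?thesis
      using assms(4) n(2) by linarith
  qed
  moreover from this have "d dvd n choose (i * P)"
    using c by (intro d(2)) linarith+
  ultimately show False
    using prime_not_dvd_binomial_mult_power[OF p(1) k(2), of i] p(2) dvd_trans
    by (auto simp: P_def)
qed

lemma has_common_divisor_diff_prime_power:
  assumes "prime p" "k > 0" "p ^ k \<le> n"
  shows "has_common_divisor n (n - p ^ k)"
  unfolding has_common_divisor_def
proof (intro exI[of _ p] conjI allI impI)
  show "p > 1"
    using assms(1) by (rule prime_gt_1_nat)
  fix m assume "n - p ^ k < m \<and> m + (n - p ^ k) < n"
  then show "p dvd n choose m"
    using assms by (intro prime_dvd_binomial_between) auto
qed

theorem theorem3:
  fixes n :: nat
  assumes "n > 0"
  shows "b n = (LEAST c. \<exists>q. prime_power q \<and> q \<le> n \<and> c = n - q)"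
proof -
  define q where "q = (GREATEST q. prime_power q \<and> q \<le> n)"
  have q: "prime_power q" "q \<le> n"
    using GreatestI_nat[of "\<lambda>q. prime_power q \<and> q \<le> n" 1 n] prime_power_1 assms
    by (simp_all add: q_def)
  have max: "q' \<le> q" if "prime_power q'" "q' \<le> n" for q'
    unfolding q_def using that by (intro Greatest_le_nat[where b = n]) auto
  have rhs: "(LEAST c. \<exists>q. prime_power q \<and> q \<le> n \<and> c = n - q) = n - q"
  proof (rule Least_equality)
    fix c assume "\<exists>q. prime_power q \<and> q \<le> n \<and> c = n - q"
    then show "n - q \<le> c"
      using max diff_le_mono2 by blast
  qed (use q in blast)
  have "b n = n - q"
  \<comment> \<open>Only for \<open>n = 1\<close> is the largest prime power the value
    \<open>p ^ 0\<close>; otherwise a prime below \<open>n\<close> forces \<open>q > 1\<close> and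
    hence a positive exponent.\<close>
  proof (cases "n = 1")
    case True
    have "q = 1"
      using True q max[OF prime_power_1] by simp
    moreover have "has_common_divisor n 0"
      unfolding has_common_divisor_def True by (intro exI[of _ 2]) auto
    ultimately show ?thesis
      by (auto simp: b_def True intro!: Least_equality)
  next
    case False
    then obtain p where p: "prime p" "p \<le> n" "2 * n \<le> 3 * p"
      using prime_between_two_thirds[of n] assms by auto
    have "prime_power p"
      using p(1) power_one_right[of p] unfolding prime_power_def by metis
    then have "p \<le> q"
      using max p(2) by blast
    then have qn: "2 * n \<le> 3 * q" "q > 1"
      using p prime_gt_1_nat[of p] by linarith+
    obtain r k where "prime r" "q = r ^ k"
      using q(1) unfolding prime_power_def by blast
    then have "has_common_divisor n (n - q)"
      using has_common_divisor_diff_prime_power[of r k n] q(2) qn(2) by (cases "k = 0") auto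
    then show ?thesis
      unfolding b_def
      by (rule Least_equality) (use has_common_divisor_imp_le q qn(1) max in blast)
  qed
  with rhs show ?thesis
    by simp
qed

end
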